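(* Let $a>1$ and $b\in\mathbb{C}$ be such that $C_{az+b}$ is a bounded composition operator on $\mathcal{H}(\beta,\Lambda)$, and suppose that $(\lambda_n)_{n\ge1}$ has precisely one zero and one non-zero initial point with respect to $a$. Then $C_{az+b}$ is not supercyclic.
   Context: $\mathbb{N}=\{1,2,\dots\}$. $\Lambda=(\lambda_n)_{n\ge1}$ is a strictly increasing sequence of non-negative real numbers tending to $\infty$ with $L:=\limsup_{n\to\infty}\frac{\log n}{\lambda_n}<\infty$. $\beta=(\beta_n)_{n\ge1}$ is a sequence of positive real numbers with $\beta_*:=\liminf_{n\to\infty}\frac{\log\beta_n}{\lambda_n}\neq\pm\infty$. For $r\in\mathbb{R}$, $\mathbb{C}_r=\{z\in\mathbb{C}:\operatorname{Re}(z)>r\}$. $\mathcal{H}(\beta,\Lambda)$ is the space of Dirichlet series $f(z)=\sum_{n=1}^\infty a_ne^{-\lambda_nz}$ with $\sum_{n=1}^\infty|a_n|^2\beta_n^2<\infty$; such series converge to holomorphic functions on $\mathbb{C}_{L/2-\beta_*}$, their coefficients are uniquely determined by $f$, and $\mathcal{H}(\beta,\Lambda)$ is a Hilbert space with inner product $\langle f,g\rangle=\sum_{n}a_n\overline{b_n}\beta_n^2$. $C_\varphi f=f\circ\varphi$ ($C_{az+b}$ is $C_\varphi$ for $\varphi(z)=az+b$); "$C_\varphi$ is a bounded composition operator on $\mathcal{H}(\beta,\Lambda)$" means that $\varphi$ is a holomorphic self-map of $\mathbb{C}_{L/2-\beta_*}$ and $C_\varphi$ maps $\mathcal{H}(\beta,\Lambda)$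 into itself boundedly. A term $\lambda_k$ is an initial point with respect to $a$ if there is no $n<k$ such that $a^s\lambda_n=\lambda_k$ for some $s\in\mathbb{N}$. Having precisely one zero and one non-zero initial point means that $\lambda_1=0$ and $\lambda_n=\lambda_2a^{n-2}$ for $n\ge2$. A bounded operator $T$ on a Hilbert space $\mathcal{H}$ is supercyclic if there is $x\in\mathcal{H}$ such that $\{\mu T^nx:n=0,1,2,\dots,\ \mu\in\mathbb{C}\}$ is dense in $\mathcal{H}$. *)

theory Defs
  imports "HOL-Complex_Analysis.Complex_Analysis"
begin

(* Sequences are indexed from 0: "lam n", "beta n" and "c n" stand for the terms with index n + 1
   of the mathematical sequences (lambda_n), (beta_n), (a_n), n >= 1.  Hence ln (real (Suc n))
   below.  If lam 0 = 0, the value of the quotients at n = 0 is irrelevant for the limits. *)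

definition dirichlet_L :: "(nat \<Rightarrow> real) \<Rightarrow> ereal" where
  "dirichlet_L lam = limsup (\<lambda>n. ereal (ln (real (Suc n)) / lam n))"

definition beta_star :: "(nat \<Rightarrow> real) \<Rightarrow> (nat \<Rightarrow> real) \<Rightarrow> ereal" where
  "beta_star beta lam = liminf (\<lambda>n. ereal (ln (beta n) / lam n))"

definition half_plane :: "real \<Rightarrow> complex set" where
  "half_plane r = {z. Re z > r}"

(* The conversions to real are meaningful only when both limits are finite. *)
definition dom_H :: "(nat \<Rightarrow> real) \<Rightarrow> (nat \<Rightarrow> real) \<Rightarrow> complex set" where
  "dom_H beta lam =
     half_plane (real_of_ereal (dirichlet_L lam) / 2 - real_of_ereal (beta_star beta lam))"

(* Functions on the half-plane are represented by total functions that vanish outside of it, so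
   that equality of functions on the half-plane is equality in HOL. *)
definition has_dirichlet_coeffs ::
  "(nat \<Rightarrow> real) \<Rightarrow> (nat \<Rightarrow> real) \<Rightarrow> (complex \<Rightarrow> complex) \<Rightarrow> (nat \<Rightarrow> complex) \<Rightarrow> bool" where
  "has_dirichlet_coeffs beta lam f c \<longleftrightarrow>
     summable (\<lambda>n. (cmod (c n))\<^sup>2 * (beta n)\<^sup>2) \<and>
     (\<forall>z\<in>dom_H beta lam. (\<lambda>n. c n * exp (- (of_real (lam n) * z))) sums f z) \<and>
     (\<forall>z. z \<notin> dom_H beta lam \<longrightarrow> f z = 0)"

definition space_H :: "(nat \<Rightarrow> real) \<Rightarrow> (nat \<Rightarrow> real) \<Rightarrow> (complex \<Rightarrow> complex) set" where
  "space_H beta lam = {f. \<exists>c. has_dirichlet_coeffs beta lam f c}"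

definition dirichlet_coeffs ::
  "(nat \<Rightarrow> real) \<Rightarrow> (nat \<Rightarrow> real) \<Rightarrow> (complex \<Rightarrow> complex) \<Rightarrow> nat \<Rightarrow> complex" where
  "dirichlet_coeffs beta lam f = (THE c. has_dirichlet_coeffs beta lam f c)"

definition inner_H ::
  "(nat \<Rightarrow> real) \<Rightarrow> (nat \<Rightarrow> real) \<Rightarrow> (complex \<Rightarrow> complex) \<Rightarrow> (complex \<Rightarrow> complex) \<Rightarrow> complex" where
  "inner_H beta lam f g =
     (\<Sum>n. dirichlet_coeffs beta lam f n * cnj (dirichlet_coeffs beta lam g n)
            * of_real ((beta n)\<^sup>2))"

definition norm_H ::
  "(nat \<Rightarrow> real) \<Rightarrow> (nat \<Rightarrow> real) \<Rightarrow> (complex \<Rightarrow> complex) \<Rightarrow> real" where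
  "norm_H beta lam f = sqrt (Re (inner_H beta lam f f))"

definition comp_op ::
  "(nat \<Rightarrow> real) \<Rightarrow> (nat \<Rightarrow> real) \<Rightarrow> (complex \<Rightarrow> complex) \<Rightarrow>
     (complex \<Rightarrow> complex) \<Rightarrow> (complex \<Rightarrow> complex)" where
  "comp_op beta lam \<phi> f = (\<lambda>z. if z \<in> dom_H beta lam then f (\<phi> z) else 0)"

definition bounded_comp_op ::
  "(nat \<Rightarrow> real) \<Rightarrow> (nat \<Rightarrow> real) \<Rightarrow> (complex \<Rightarrow> complex) \<Rightarrow> bool" where
  "bounded_comp_op beta lam \<phi> \<longleftrightarrow>
     \<phi> holomorphic_on dom_H beta lam \<and>
     \<phi> ` dom_H beta lam \<subseteq> dom_H beta lam \<and>
     (\<forall>f\<in>space_H beta lam. comp_op beta lam \<phi> f \<in> space_H beta lam) \<and>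
     (\<exists>K. \<forall>f\<in>space_H beta lam.
        norm_H beta lam (comp_op beta lam \<phi> f) \<le> K * norm_H beta lam f)"

definition dense_in_H ::
  "(nat \<Rightarrow> real) \<Rightarrow> (nat \<Rightarrow> real) \<Rightarrow> (complex \<Rightarrow> complex) set \<Rightarrow> bool" where
  "dense_in_H beta lam S \<longleftrightarrow>
     S \<subseteq> space_H beta lam \<and>
     (\<forall>f\<in>space_H beta lam. \<forall>e>0. \<exists>g\<in>S. norm_H beta lam (\<lambda>z. f z - g z) < e)"

definition supercyclic_on_H ::
  "(nat \<Rightarrow> real) \<Rightarrow> (nat \<Rightarrow> real) \<Rightarrow>
     ((complex \<Rightarrow> complex) \<Rightarrow> (complex \<Rightarrow> complex)) \<Rightarrow> bool" where
  "supercyclic_on_H beta lam T \<longleftrightarrow>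
     (\<exists>f\<in>space_H beta lam. dense_in_H beta lam {(\<lambda>z. \<mu> * (T ^^ n) f z) | (\<mu>::complex) (n::nat). True})"

definition initial_point :: "real \<Rightarrow> (nat \<Rightarrow> real) \<Rightarrow> nat \<Rightarrow> bool" where
  "initial_point a lam k \<longleftrightarrow> \<not> (\<exists>n<k. \<exists>s::nat. s \<ge> 1 \<and> a ^ s * lam n = lam k)"

definition one_zero_one_nonzero_initial :: "real \<Rightarrow> (nat \<Rightarrow> real) \<Rightarrow> bool" where
  "one_zero_one_nonzero_initial a lam \<longleftrightarrow>
     (\<exists>!k. initial_point a lam k \<and> lam k = 0) \<and>
     (\<exists>!k. initial_point a lam k \<and> lam k \<noteq> 0)"

(* The converse holds as soon as "lam" is strictly increasing and non-negative and its range is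
   closed under multiplication by a; the latter is necessary for the composition operator with
   symbol a * z + b to map the space into itself. *)
lemma one_zero_one_nonzero_initial_geometric:
  assumes "strict_mono lam" "lam 0 = 0" "\<And>n. n \<ge> 1 \<Longrightarrow> lam n = lam 1 * a ^ (n - 1)"
  shows "one_zero_one_nonzero_initial a lam"
proof -
  have zero_iff: "lam k = 0 \<longleftrightarrow> k = 0" for k
    using strict_mono_eq[OF assms(1), of k 0] assms(2) by simp
  have not_init: "\<not> initial_point a lam k" if "k \<ge> 2" for k
  proof -
    have "a ^ (k - 1) * lam 1 = lam k" using assms(3)[of k] that by simp
    moreover have "1 < k" "k - 1 \<ge> 1" using that by auto
    ultimately show ?thesis unfolding initial_point_def by blast
  qed
  have "initial_point a lam 0" by (simp add: initial_point_def)
  moreover have "initial_point a lam 1"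
    using assms(2) zero_iff[of 1] unfolding initial_point_def
    by (metis less_one mult_zero_right one_neq_zero)
  moreover have "k = 1" if "initial_point a lam k" "lam k \<noteq> 0" for k
  proof -
    have "k \<noteq> 0" using that(2) zero_iff by blast
    moreover have "\<not> k \<ge> 2" using not_init that(1) by blast
    ultimately show ?thesis by linarith
  qed
  ultimately have "\<exists>!k. initial_point a lam k \<and> lam k = 0"
    and "\<exists>!k. initial_point a lam k \<and> lam k \<noteq> 0"
    using zero_iff one_neq_zero by metis+
  then show ?thesis
    unfolding one_zero_one_nonzero_initial_def by blast
qed

end

theory Submission
  imports Defs
begin

text \<open>
  The operator fixes the constants and sends the exponential with frequency \<open>\<lambda>\<close> to a multiple of
  the exponential with frequency \<open>a * \<lambda>\<close>.  Since \<open>a > 1\<close>, nothing is sent to the smallest positive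
  frequency: on the complement of the constants the operator is a forward weighted shift.  So every
  function in its range has coefficient zero at this frequency
  (\<open>comp_op_second_coeff_zero\<close>).  Hence every projective orbit lies in the union of the
  line through its starting vector and a closed hyperplane.  Looking only at the coefficients at the
  two smallest frequencies, which depend continuously on the function
  (\<open>coeff_le_norm_H\<close>), one finds a linear combination of the two corresponding
  exponentials that stays away from this union.

  The analytic ingredient is that a Dirichlet series determines its coefficients, in the form that
  its leading coefficient is recovered from its growth along the positive real axis
  (\<open>dirichlet_series_leading_coeff\<close>).  This growth comparison also applies to two expansions of the
  same function along different sequences of frequencies, which is what happens for the composition
  with \<open>a * z + b\<close>: one expansion uses the frequencies themselves, the other their multiples by \<open>a\<close>.
\<close>

section \<open>Leading coefficients of Dirichlet series\<close>

lemma tendsto_exp_minus_mult_at_top: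
  fixes d :: real
  assumes "d > 0"
  shows "((\<lambda>x. exp (- (d * x))) \<longlongrightarrow> 0) at_top"
  using assms
  by (intro filterlim_compose[OF exp_at_bot])
    (auto simp: filterlim_uminus_at_bot intro!: filterlim_tendsto_pos_mult_at_top filterlim_ident)

text \<open>
  After multiplication by \<open>exp (mu k * x)\<close> all terms beyond the \<open>k\<close>-th decay at least like
  \<open>exp (- (mu (k + 1) - mu k) * x)\<close>, and they do so uniformly because the series converges absolutely
  far enough to the right: its terms are bounded at one point, and moving right by \<open>t\<close> gains
  the summable factor \<open>exp (- (t * mu n))\<close>.
\<close>

lemma dirichlet_series_leading_coeff:
  fixes mu :: "nat \<Rightarrow> real" and c :: "nat \<Rightarrow> complex" and F :: "real \<Rightarrow> complex"
  assumes mono: "strict_mono mu"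
    and summ: "summable (\<lambda>n. exp (- (t * mu n)))"
    and sums: "\<And>x. x > r \<Longrightarrow> (\<lambda>n. c n * of_real (exp (- (mu n * x)))) sums F x"
    and zero: "\<And>n. n < k \<Longrightarrow> c n = 0"
  shows "((\<lambda>x. of_real (exp (mu k * x)) * F x) \<longlongrightarrow> c k) at_top"
proof -
  define x0 where "x0 = r + 1"
  define x1 where "x1 = x0 + t"
  define \<delta> where "\<delta> = mu (Suc k) - mu k"
  have \<delta>: "\<delta> > 0" using mono by (simp add: \<delta>_def strict_mono_def)
  have "summable (\<lambda>n. c n * of_real (exp (- (mu n * x0))))"
    using sums[of x0] by (auto simp: x0_def sums_iff)
  then have "Bseq (\<lambda>n. c n * of_real (exp (- (mu n * x0))))"
    by (rule summable_imp_Bseq)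
  then obtain M where M: "\<And>n. norm (c n * of_real (exp (- (mu n * x0)))) \<le> M"
    unfolding Bseq_def by blast
  define K where "K n = exp (mu k * x1) * (norm (c n) * exp (- (mu n * x1)))" for n
  have "norm (norm (c n) * exp (- (mu n * x1))) \<le> M * exp (- (t * mu n))" for n
  proof -
    have "norm (c n) * exp (- (mu n * x1))
        = (norm (c n) * exp (- (mu n * x0))) * exp (- (t * mu n))"
      by (simp add: x1_def mult_exp_exp algebra_simps)
    also have "\<dots> \<le> M * exp (- (t * mu n))"
      using M[of n] by (intro mult_right_mono) (auto simp: norm_mult)
    finally show ?thesis by simp
  qed
  then have "summable (\<lambda>n. norm (c n) * exp (- (mu n * x1)))"
    by (intro summable_comparison_test'[OF summable_mult[OF summ, of M], of 0]) auto
  then have sK: "summable K" unfolding K_def by (rule summable_mult)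
  have bound: "norm (of_real (exp (mu k * x)) * F x - c k) \<le> suminf K * exp (- (\<delta> * (x - x1)))"
    if x: "x > r" "x \<ge> x1" for x
  proof -
    define h where "h n = of_real (exp (mu k * x)) * (c n * of_real (exp (- (mu n * x))))
        - (if n = k then c k else 0)" for n
    have "h sums (of_real (exp (mu k * x)) * F x - c k)"
      unfolding h_def by (intro sums_diff sums_mult sums[OF x(1)] sums_single[of k "\<lambda>_. c k", simplified])
    then have eq: "of_real (exp (mu k * x)) * F x - c k = suminf h" by (simp add: sums_iff)
    have le: "norm (h n) \<le> K n * exp (- (\<delta> * (x - x1)))" for n
    proof -
      consider "n < k" | "n = k" | "n > k" by linarith
      then show ?thesis
      proof cases
        case 1 then show ?thesis by (simp add: h_def K_def zero)
      next
        case 2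
        have "h k = 0"
          by (simp add: h_def flip: of_real_mult exp_minus exp_add)
        then show ?thesis using 2 by (simp add: K_def)
      next
        case 3
        then have "mu (Suc k) \<le> mu n" using mono by (simp add: strict_mono_less_eq)
        then have "\<delta> * (x - x1) \<le> (mu n - mu k) * (x - x1)"
          using x by (intro mult_right_mono) (auto simp: \<delta>_def)
        then have e: "mu k * x + - (mu n * x) \<le> mu k * x1 + - (mu n * x1) + - (\<delta> * (x - x1))"
          by (simp add: algebra_simps)
        have "norm (h n) = norm (c n) * exp (mu k * x + - (mu n * x))"
          using 3 by (simp only: h_def exp_add) (simp add: norm_mult)
        also have "\<dots> \<le> norm (c n) * exp (mu k * x1 + - (mu n * x1) + - (\<delta> * (x - x1)))"
          using e by (intro mult_left_mono) auto
        also have "\<dots> = K n * exp (- (\<delta> * (x - x1)))"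
          by (simp only: K_def exp_add mult_ac)
        finally show ?thesis .
      qed
    qed
    have "norm (suminf h) \<le> (\<Sum>n. K n * exp (- (\<delta> * (x - x1))))"
      by (rule norm_suminf_le[OF le summable_mult2[OF sK]])
    also have "\<dots> = suminf K * exp (- (\<delta> * (x - x1)))"
      by (rule suminf_mult2[OF sK, symmetric])
    finally show ?thesis by (simp add: eq)
  qed
  have "((\<lambda>x. suminf K * exp (\<delta> * x1) * exp (- (\<delta> * x)))
      \<longlongrightarrow> suminf K * exp (\<delta> * x1) * 0) at_top"
    by (intro tendsto_mult_left tendsto_exp_minus_mult_at_top \<delta>)
  then have "((\<lambda>x. suminf K * exp (- (\<delta> * (x - x1)))) \<longlongrightarrow> 0) at_top"
    by (simp add: right_diff_distrib mult.assoc flip: exp_add)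
  then have "((\<lambda>x. of_real (exp (mu k * x)) * F x - c k) \<longlongrightarrow> 0) at_top"
    by (rule Lim_null_comparison[rotated])
      (use eventually_gt_at_top[of r] eventually_ge_at_top[of x1] in eventually_elim, rule bound)
  then show ?thesis by (simp add: LIM_zero_iff)
qed

text \<open>
  A finite upper limit of \<open>ln n / lam n\<close> bounds \<open>exp (- (t * lam n))\<close>, for \<open>t\<close> large, by the
  inverse squares.
\<close>

lemma summable_exp_of_dirichlet_L_finite:
  assumes lim: "filterlim lam at_top sequentially" and L: "dirichlet_L lam < \<infinity>"
  obtains t where "summable (\<lambda>n. exp (- (t * lam n)))"
proof -
  obtain C :: nat where "dirichlet_L lam < ereal (real C)"
    using L less_PInf_Ex_of_nat[of "dirichlet_L lam"] by auto
  then have "\<forall>\<^sub>F n in sequentially. ereal (ln (real (Suc n)) / lam n) < ereal (real C)"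
    unfolding dirichlet_L_def by (rule Limsup_lessD)
  moreover have "\<forall>\<^sub>F n in sequentially. lam n > 0"
    using lim by (simp add: filterlim_at_top_dense)
  ultimately have "\<forall>\<^sub>F n in sequentially.
      norm (exp (- (2 * real C * lam n))) \<le> inverse ((real (Suc n)) ^ 2)"
  proof eventually_elim
    case (elim n)
    then have "ln (real (Suc n)) \<le> real C * lam n" by (simp add: field_simps)
    then have "exp (- (2 * real C * lam n)) \<le> exp (- (2 * ln (real (Suc n))))" by simp
    also have "\<dots> = inverse (exp (ln (real (Suc n))) ^ 2)"
      by (simp only: exp_minus exp_double)
    finally show ?case by simp
  qed
  moreover have "summable (\<lambda>n. inverse ((real (Suc n)) ^ 2))"
    using inverse_power_summable[of 2, where ?'a = real] by (subst summable_Suc_iff) simp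
  ultimately have "summable (\<lambda>n. exp (- (2 * real C * lam n)))"
    by (rule summable_comparison_test_ev)
  then show ?thesis by (rule that)
qed

section \<open>Coefficients in the weighted space\<close>

lemma has_dirichlet_coeffs_sums:
  assumes "has_dirichlet_coeffs beta lam f c" "z \<in> dom_H beta lam"
  shows "(\<lambda>n. c n * exp (- (of_real (lam n) * z))) sums f z"
  using assms by (auto simp: has_dirichlet_coeffs_def)

lemma has_dirichlet_coeffs_diff:
  assumes "has_dirichlet_coeffs beta lam f c" "has_dirichlet_coeffs beta lam g d"
  shows "has_dirichlet_coeffs beta lam (\<lambda>z. f z - g z) (\<lambda>n. c n - d n)"
proof -
  have bound: "(cmod (c n - d n))\<^sup>2 * (beta n)\<^sup>2
      \<le> 2 * ((cmod (c n))\<^sup>2 * (beta n)\<^sup>2) + 2 * ((cmod (d n))\<^sup>2 * (beta n)\<^sup>2)" for n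
  proof -
    have "(cmod (c n - d n))\<^sup>2 \<le> (cmod (c n) + cmod (d n))\<^sup>2"
      by (intro power_mono norm_triangle_ineq4) auto
    also have "\<dots> \<le> 2 * (cmod (c n))\<^sup>2 + 2 * (cmod (d n))\<^sup>2"
      using sum_squares_bound[of "cmod (c n)" "cmod (d n)"] by (simp add: power2_sum)
    finally have "(cmod (c n - d n))\<^sup>2 * (beta n)\<^sup>2
        \<le> (2 * (cmod (c n))\<^sup>2 + 2 * (cmod (d n))\<^sup>2) * (beta n)\<^sup>2"
      by (rule mult_right_mono) simp
    then show ?thesis by (simp add: algebra_simps)
  qed
  have "summable (\<lambda>n. 2 * ((cmod (c n))\<^sup>2 * (beta n)\<^sup>2)
      + 2 * ((cmod (d n))\<^sup>2 * (beta n)\<^sup>2))"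
    using assms by (intro summable_add summable_mult) (auto simp: has_dirichlet_coeffs_def)
  then have "summable (\<lambda>n. (cmod (c n - d n))\<^sup>2 * (beta n)\<^sup>2)"
    by (rule summable_comparison_test'[where N = 0]) (simp add: bound)
  then show ?thesis
    using assms unfolding has_dirichlet_coeffs_def
    by (auto simp: left_diff_distrib intro!: sums_diff)
qed

lemma has_dirichlet_coeffs_mult:
  assumes "has_dirichlet_coeffs beta lam f c"
  shows "has_dirichlet_coeffs beta lam (\<lambda>z. \<mu> * f z) (\<lambda>n. \<mu> * c n)"
  using assms unfolding has_dirichlet_coeffs_def
  by (auto simp: norm_mult power_mult_distrib mult.assoc intro!: summable_mult sums_mult)

lemma has_dirichlet_coeffs_finite:
  assumes "finite N" "\<And>n. n \<notin> N \<Longrightarrow> c n = 0"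
  shows "has_dirichlet_coeffs beta lam
    (\<lambda>z. if z \<in> dom_H beta lam then \<Sum>n\<in>N. c n * exp (- (of_real (lam n) * z)) else 0) c"
  using assms unfolding has_dirichlet_coeffs_def
  by (auto intro!: sums_finite summable_finite[of N])

lemma has_dirichlet_coeffs_unique:
  assumes mono: "strict_mono lam"
    and lim: "filterlim lam at_top sequentially" and L: "dirichlet_L lam < \<infinity>"
    and c: "has_dirichlet_coeffs beta lam f c" and d: "has_dirichlet_coeffs beta lam f d"
  shows "c = d"
proof
  fix k
  obtain t where t: "summable (\<lambda>n. exp (- (t * lam n)))"
    using summable_exp_of_dirichlet_L_finite[OF lim L] .
  define r where "r = real_of_ereal (dirichlet_L lam) / 2 - real_of_ereal (beta_star beta lam)"
  have sums0: "(\<lambda>n. (c n - d n) * of_real (exp (- (lam n * x)))) sums 0" if "x > r" for x :: real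
  proof -
    have "of_real x \<in> dom_H beta lam" using that by (simp add: dom_H_def half_plane_def r_def)
    from has_dirichlet_coeffs_sums[OF has_dirichlet_coeffs_diff[OF c d] this]
    show ?thesis by (simp flip: exp_of_real)
  qed
  show "c k = d k"
  proof (induction k rule: less_induct)
    case (less k)
    have "((\<lambda>x. of_real (exp (lam k * x)) * 0) \<longlongrightarrow> c k - d k) at_top"
      by (rule dirichlet_series_leading_coeff[OF mono t sums0]) (simp_all add: less)
    then show ?case
      using tendsto_unique[of at_top "\<lambda>x::real. 0::complex" "c k - d k" 0] by simp
  qed
qed

lemma coeff_le_norm_H:
  assumes mono: "strict_mono lam"
    and lim: "filterlim lam at_top sequentially" and L: "dirichlet_L lam < \<infinity>"
    and c: "has_dirichlet_coeffs beta lam f c"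
  shows "cmod (c k) * beta k \<le> norm_H beta lam f"
proof -
  have coeffs: "dirichlet_coeffs beta lam f = c"
    unfolding dirichlet_coeffs_def
  proof (rule the_equality)
    show "d = c" if "has_dirichlet_coeffs beta lam f d" for d
      using has_dirichlet_coeffs_unique[OF mono lim L that c] .
  qed (rule c)
  have summ: "summable (\<lambda>n. (cmod (c n))\<^sup>2 * (beta n)\<^sup>2)"
    using c by (simp add: has_dirichlet_coeffs_def)
  have eq: "c n * cnj (c n) * of_real ((beta n)\<^sup>2)
      = complex_of_real ((cmod (c n))\<^sup>2 * (beta n)\<^sup>2)" for n
    using complex_norm_square[of "c n"] by simp
  have "inner_H beta lam f f = (\<Sum>n. complex_of_real ((cmod (c n))\<^sup>2 * (beta n)\<^sup>2))"
    by (simp only: inner_H_def coeffs eq)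
  also have "\<dots> = of_real (\<Sum>n. (cmod (c n))\<^sup>2 * (beta n)\<^sup>2)"
    by (rule suminf_of_real[OF summ, symmetric])
  finally have "norm_H beta lam f = sqrt (\<Sum>n. (cmod (c n))\<^sup>2 * (beta n)\<^sup>2)"
    by (simp add: norm_H_def)
  moreover have "(cmod (c k) * beta k)\<^sup>2 \<le> (\<Sum>n. (cmod (c n))\<^sup>2 * (beta n)\<^sup>2)"
    using sum_le_suminf[OF summ, of "{k}"] by (simp add: power_mult_distrib)
  ultimately show ?thesis
    by (metis real_le_rsqrt)
qed

section \<open>The range of the composition operator\<close>

text \<open>
  Write \<open>g\<close> for the composition.  The value of \<open>g\<close> at \<open>+\<infinity>\<close> is the constant coefficient of both of
  its expansions.  Once it is subtracted, the expansion obtained from the composition shows that \<open>g\<close>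
  decays at least like \<open>exp (- (a * lam 1 * x))\<close>, which is faster than \<open>exp (- (lam 1 * x))\<close>.
\<close>

lemma comp_op_second_coeff_zero:
  assumes mono: "strict_mono lam"
    and lim: "filterlim lam at_top sequentially" and L: "dirichlet_L lam < \<infinity>"
    and a: "a > 1" and lam0: "lam 0 = 0"
    and self: "(\<lambda>z. of_real a * z + b) ` dom_H beta lam \<subseteq> dom_H beta lam"
    and f: "has_dirichlet_coeffs beta lam f c"
    and Tf: "has_dirichlet_coeffs beta lam (comp_op beta lam (\<lambda>z. of_real a * z + b) f) d"
  shows "d 1 = 0"
proof -
  obtain t where t: "summable (\<lambda>n. exp (- (t * lam n)))"
    using summable_exp_of_dirichlet_L_finite[OF lim L] .
  then have ta: "summable (\<lambda>n. exp (- ((t / a) * (a * lam n))))" using a by simp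
  have monoa: "strict_mono (\<lambda>n. a * lam n)" using mono a by (simp add: strict_mono_def)
  have lam1: "lam 1 > 0" using mono lam0 by (metis strict_mono_less zero_less_one)
  define r where "r = real_of_ereal (dirichlet_L lam) / 2 - real_of_ereal (beta_star beta lam)"
  define G where "G x = f (of_real a * of_real x + b)" for x :: real
  define c' where "c' n = c n * exp (- (of_real (lam n) * b))" for n
  have dom: "of_real x \<in> dom_H beta lam" if "x > r" for x :: real
    using that by (simp add: dom_H_def half_plane_def r_def)
  have sd: "(\<lambda>n. d n * of_real (exp (- (lam n * x)))) sums G x" if "x > r" for x
    using has_dirichlet_coeffs_sums[OF Tf dom[OF that]] dom[OF that]
    by (simp add: comp_op_def G_def flip: exp_of_real)
  have sc: "(\<lambda>n. c' n * of_real (exp (- (a * lam n * x)))) sums G x" if "x > r" for x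
  proof -
    have "of_real a * of_real x + b \<in> dom_H beta lam" using self dom[OF that] by blast
    from has_dirichlet_coeffs_sums[OF f this]
    have "(\<lambda>n. c n * exp (- (of_real (lam n) * (of_real a * of_real x + b)))) sums G x"
      by (simp add: G_def)
    moreover have "c n * exp (- (of_real (lam n) * (of_real a * of_real x + b)))
        = c' n * of_real (exp (- (a * lam n * x)))" for n
      by (simp add: c'_def mult_exp_exp algebra_simps flip: exp_of_real)
    ultimately show ?thesis by simp
  qed
  have "(G \<longlongrightarrow> d 0) at_top" "(G \<longlongrightarrow> c' 0) at_top"
    using dirichlet_series_leading_coeff[OF mono t sd, where k = 0]
      dirichlet_series_leading_coeff[OF monoa ta sc, where k = 0] lam0 by simp_all
  then have eq0: "c' 0 = d 0" by (intro tendsto_unique[of at_top G]) auto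
  have drop: "(\<lambda>n. (e(0 := 0)) n * of_real (exp (- (mu n * x)))) sums (G x - e 0)"
    if "(\<lambda>n. e n * of_real (exp (- (mu n * x)))) sums G x" "mu 0 = 0"
    for e :: "nat \<Rightarrow> complex" and mu :: "nat \<Rightarrow> real" and x
  proof -
    have "(\<lambda>n. e n * of_real (exp (- (mu n * x))) - (if n = 0 then e 0 else 0)) sums (G x - e 0)"
      by (intro sums_diff that(1) sums_single[of 0 "\<lambda>_. e 0", simplified])
    also have "(\<lambda>n. e n * of_real (exp (- (mu n * x))) - (if n = 0 then e 0 else 0))
        = (\<lambda>n. (e(0 := 0)) n * of_real (exp (- (mu n * x))))"
      using that(2) by auto
    finally show ?thesis .
  qed
  have limd: "((\<lambda>x. of_real (exp (lam 1 * x)) * (G x - d 0)) \<longlongrightarrow> d 1) at_top"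
    using dirichlet_series_leading_coeff[OF mono t drop[OF sd lam0], of r 1] by simp
  have limc: "((\<lambda>x. of_real (exp (a * lam 1 * x)) * (G x - d 0)) \<longlongrightarrow> c' 1) at_top"
    using dirichlet_series_leading_coeff[OF monoa ta drop[OF sc], of r 1] lam0 eq0 by simp
  have "(a - 1) * lam 1 > 0" using a lam1 by simp
  then have "((\<lambda>x. exp (- ((a - 1) * lam 1 * x))) \<longlongrightarrow> 0) at_top"
    by (rule tendsto_exp_minus_mult_at_top)
  then have "((\<lambda>x. complex_of_real (exp (- ((a - 1) * lam 1 * x)))) \<longlongrightarrow> 0) at_top"
    by (metis tendsto_of_real of_real_0)
  from tendsto_mult[OF this limc]
  have "((\<lambda>x. of_real (exp (- ((a - 1) * lam 1 * x)) * exp (a * lam 1 * x)) * (G x - d 0))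
      \<longlongrightarrow> 0) at_top"
    by (simp add: mult.assoc)
  also have "(\<lambda>x. of_real (exp (- ((a - 1) * lam 1 * x)) * exp (a * lam 1 * x)) * (G x - d 0))
      = (\<lambda>x. of_real (exp (lam 1 * x)) * (G x - d 0))"
    by (simp add: left_diff_distrib flip: exp_add)
  finally have "((\<lambda>x. of_real (exp (lam 1 * x)) * (G x - d 0)) \<longlongrightarrow> 0) at_top" .
  then show ?thesis using limd by (intro tendsto_unique) auto
qed

lemma one_zero_one_nonzero_initial_first:
  assumes "strict_mono lam" "\<And>n. lam n \<ge> 0" "one_zero_one_nonzero_initial a lam"
  shows "lam 0 = 0"
proof -
  obtain k where "lam k = 0"
    using assms(3) unfolding one_zero_one_nonzero_initial_def by blast
  moreover have "lam 0 \<le> lam k" using assms(1) by (simp add: strict_mono_less_eq)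
  ultimately show ?thesis using assms(2)[of 0] by simp
qed

section \<open>Supercyclicity\<close>

theorem proposition5p18:
  fixes lam beta :: "nat \<Rightarrow> real" and a :: real and b :: complex
  assumes "strict_mono lam"
    and "\<And>n. lam n \<ge> 0"
    and "filterlim lam at_top sequentially"
    and "dirichlet_L lam < \<infinity>"
    and "\<And>n. beta n > 0"
    and "beta_star beta lam \<noteq> \<infinity>" and "beta_star beta lam \<noteq> - \<infinity>"
    and "a > 1"
    and "bounded_comp_op beta lam (\<lambda>z. of_real a * z + b)"
    and "one_zero_one_nonzero_initial a lam"
  shows "\<not> supercyclic_on_H beta lam (comp_op beta lam (\<lambda>z. of_real a * z + b))"
proof
  let ?T = "comp_op beta lam (\<lambda>z. of_real a * z + b)"
  assume "supercyclic_on_H beta lam ?T"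
  then obtain f where f: "f \<in> space_H beta lam"
    and dense: "dense_in_H beta lam {(\<lambda>z. \<mu> * (?T ^^ n) f z) | (\<mu>::complex) (n::nat). True}"
    unfolding supercyclic_on_H_def by blast
  obtain c where c: "has_dirichlet_coeffs beta lam f c" using f by (auto simp: space_H_def)
  have self: "(\<lambda>z. of_real a * z + b) ` dom_H beta lam \<subseteq> dom_H beta lam"
    and T_space: "\<And>g. g \<in> space_H beta lam \<Longrightarrow> ?T g \<in> space_H beta lam"
    using assms(9) unfolding bounded_comp_op_def by blast+
  have lam0: "lam 0 = 0"
    using one_zero_one_nonzero_initial_first[OF assms(1,2,10)] .
  have orbit_space: "(?T ^^ n) f \<in> space_H beta lam" for n
    by (induction n) (simp_all add: f T_space)
  have beta: "beta 0 > 0" "beta 1 > 0" using assms(5) by auto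
  \<comment> \<open>Project to the first two coefficients.  If \<open>c 1 \<noteq> 0\<close>, then \<open>f\<close> is mapped to a multiple of
    \<open>(q, 1)\<close>, so the point \<open>(q + 1, 1)\<close> lies neither on the line through this image nor on the line
    where the second coordinate vanishes; \<open>\<epsilon>\<close> is a lower bound for its distance from both.  If
    \<open>c 1 = 0\<close>, then the first line is contained in the second, and the default value \<open>q = 0\<close> does.\<close>
  define q where "q = c 0 / c 1"
  define \<epsilon> where "\<epsilon> = min (beta 1) (1 / (1 / beta 0 + cmod q / beta 1))"
  have den: "1 / beta 0 + cmod q / beta 1 > 0" using beta by (simp add: add_pos_nonneg)
  have \<epsilon>: "\<epsilon> > 0" using beta den by (simp add: \<epsilon>_def)
  define h where "h n = (if n = 0 then q + 1 else if n = 1 then 1 else 0)" for n :: nat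
  obtain H where H: "has_dirichlet_coeffs beta lam H h"
    using has_dirichlet_coeffs_finite[of "{0, 1}" h beta lam] by (auto simp: h_def)
  then have "H \<in> space_H beta lam" by (auto simp: space_H_def)
  then obtain \<mu> n where near: "norm_H beta lam (\<lambda>z. H z - \<mu> * (?T ^^ n) f z) < \<epsilon>"
    using dense \<epsilon> unfolding dense_in_H_def by blast
  have coeff_near: "cmod (h k - \<mu> * d k) * beta k < \<epsilon>"
    if "has_dirichlet_coeffs beta lam ((?T ^^ n) f) d" for k d
    using coeff_le_norm_H[OF assms(1,3,4)
        has_dirichlet_coeffs_diff[OF H has_dirichlet_coeffs_mult[OF that]]] near
    by (rule le_less_trans)
  \<comment> \<open>\<open>\<epsilon> \<le> beta 1\<close> keeps the approximating function off the hyperplane.\<close>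
  have nonzero: "d 1 \<noteq> 0" if "has_dirichlet_coeffs beta lam ((?T ^^ n) f) d" for d
    using coeff_near[OF that, of 1] by (auto simp: h_def \<epsilon>_def)
  show False
  proof (cases n)
    case 0
    then have cn: "has_dirichlet_coeffs beta lam ((?T ^^ n) f) c" using c by simp
    have "c 1 \<noteq> 0" using nonzero[OF cn] .
    then have "1 = (h 0 - \<mu> * c 0) - (h 1 - \<mu> * c 1) * q"
      by (simp add: h_def q_def field_simps)
    then have "1 = cmod ((h 0 - \<mu> * c 0) - (h 1 - \<mu> * c 1) * q)" by (metis norm_one)
    also have "\<dots> \<le> cmod (h 0 - \<mu> * c 0) + cmod (h 1 - \<mu> * c 1) * cmod q"
      by (metis norm_mult norm_triangle_ineq4)
    also have "\<dots> < \<epsilon> / beta 0 + \<epsilon> / beta 1 * cmod q"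
      using coeff_near[OF cn, of 0] coeff_near[OF cn, of 1] beta
      by (intro add_less_le_mono mult_right_mono) (auto simp: field_simps)
    also have "\<dots> = \<epsilon> * (1 / beta 0 + cmod q / beta 1)" by (simp add: algebra_simps)
    also have "\<dots> \<le> (1 / (1 / beta 0 + cmod q / beta 1)) * (1 / beta 0 + cmod q / beta 1)"
      using den by (intro mult_right_mono) (auto simp: \<epsilon>_def)
    also have "\<dots> = 1" using den by simp
    finally show False by simp
  next
    case (Suc m)
    obtain d where d: "has_dirichlet_coeffs beta lam ((?T ^^ m) f) d"
      using orbit_space[of m] by (auto simp: space_H_def)
    obtain e where e: "has_dirichlet_coeffs beta lam ((?T ^^ n) f) e"
      using orbit_space[of n] by (auto simp: space_H_def)
    then have "e 1 = 0"
      using comp_op_second_coeff_zero[OF assms(1,3,4,8) lam0 self d] Suc by simp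
    then show False using nonzero[OF e] by simp
  qed
qed

end
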